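(* In the ring of formal power series in the variable $q$, $$\sum_{m,r\ge 0} \frac{q^{4m^2+4mr+2r^2-r}}{(q^4;q^4)_m\,(q^2;q^2)_r} = \prod_{n=1}^\infty (1+q^{2n-1}),$$ where the sum is over all pairs of non-negative integers $(m,r)$.
   Context: $q$ is a formal variable. For an integer $n\ge 0$, $(a;q)_n=(1-a)(1-aq)(1-aq^2)\cdots(1-aq^{n-1})$, with $(a;q)_0=1$. Replacing the base $q$ by $q^k$ gives $(a;q^k)_n=\prod_{j=0}^{n-1}(1-aq^{kj})$; thus $(q^4;q^4)_m=\prod_{j=1}^{m}(1-q^{4j})$ and $(q^2;q^2)_r=\prod_{j=1}^{r}(1-q^{2j})$. Infinite sums and products are understood in the usual topology of formal power series, and reciprocals are those of power series with constant term $1$. *)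

theory Defs
  imports "HOL-Analysis.Analysis" "HOL-Computational_Algebra.Formal_Power_Series"
begin

definition qpoch :: "'a::comm_ring_1 \<Rightarrow> 'a \<Rightarrow> nat \<Rightarrow> 'a" where
  "qpoch a q n = (\<Prod>j<n. 1 - a * q ^ j)"

text \<open>
  Sums and products of type \<open>'a fps\<close> are taken with respect to the library metric on formal
  power series, whose topology is the \<open>X\<close>-adic one with discrete coefficients. Division of
  power series requires a coefficient type with inverses, here a field; divisors with constant term
  \<open>1\<close> are units, so there \<open>f / g\<close> is \<open>f\<close> times the power series reciprocal of \<open>g\<close>.
  An exponent of the form \<open>2 * r^2 - r\<close> in \<open>nat\<close> involves no truncation, as
  \<open>r \<le> 2 * r^2\<close>.
\<close>

end

theory Submission
  imports Defs
begin

text \<open>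
  With \<open>n = 2 * m + r\<close> the exponent is \<open>n^2 + r * (r - 1)\<close>. For fixed \<open>n\<close> the inner sum
  is, with \<open>Q = q^2\<close>, the coefficient of \<open>z^n\<close> in
  \<open>(-z; Q)\<^sub>\<infinity> / (z^2; Q^2)\<^sub>\<infinity> = 1 / (z; Q)\<^sub>\<infinity>\<close>, which is \<open>1 / (Q; Q)\<^sub>n\<close>.
  What remains is Euler's identity for \<open>\<Sum>n. q^(n^2) / (q^2; q^2)\<^sub>n\<close>.
\<close>

unbundle no vec_syntax and fps_syntax

section \<open>q-Pochhammer symbols as power series\<close>

lemma qpoch_Suc: "qpoch a q (Suc n) = qpoch a q n * (1 - a * q ^ n)"
  by (simp add: qpoch_def)

lemma qpoch_nth_0:
  fixes a q :: "'a::field fps"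
  assumes "a $ 0 = 0"
  shows "qpoch a q n $ 0 = 1"
  by (induction n) (simp_all add: qpoch_Suc, simp_all add: qpoch_def assms)

text \<open>The last factor of the symbol is a unit, so it cancels. This recurrence drives both
  functional equations, the recovery of coefficients from them, and Euler's telescoping.\<close>

lemma inverse_qpoch_Suc:
  fixes Q :: "'a::field fps"
  assumes "Q $ 0 = 0"
  shows "(1 - Q ^ Suc n) * inverse (qpoch Q Q (Suc n)) = inverse (qpoch Q Q n)"
proof -
  have "(1 - Q ^ Suc n) * inverse (1 - Q ^ Suc n) = 1"
    by (rule inverse_mult_eq_1') (simp add: assms)
  then show ?thesis
    by (simp add: qpoch_Suc fps_inverse_mult mult.assoc mult.left_commute)
qed

section \<open>The inner sum, by generating functions in \<open>z\<close>\<close>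

text \<open>
  \<open>E\<close> and \<open>D\<close> are the expansions of \<open>(-z; Q)\<^sub>\<infinity>\<close> and \<open>1 / (z^2; Q^2)\<^sub>\<infinity>\<close>, as
  power series in \<open>z\<close> over \<open>'a fps\<close>, and \<open>S\<close> substitutes \<open>Q * z\<close> for \<open>z\<close>. Their
  functional equations combine to \<open>(1 - z) * (E * D) = S (E * D)\<close>, the recurrence of
  \<open>1 / (Q; Q)\<^sub>n\<close>.
\<close>
lemma inverse_qpoch_eq_sum:
  fixes Q :: "'a::field fps"
  assumes Q: "Q $ 0 = 0"
  shows "inverse (qpoch Q Q n) =
    (\<Sum>r | r \<le> n \<and> even (n - r).
       Q ^ (r choose 2) * inverse (qpoch Q Q r) * inverse (qpoch (Q^2) (Q^2) ((n - r) div 2)))"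
proof -
  define E where "E = Abs_fps (\<lambda>r. Q ^ (r choose 2) * inverse (qpoch Q Q r))"
  define D where
    "D = Abs_fps (\<lambda>n. if even n then inverse (qpoch (Q^2) (Q^2) (n div 2)) else 0)"
  define S where "S F = F oo (fps_const Q * fps_X)" for F :: "'a fps fps"
  have S_nth: "S F $ n = Q ^ n * F $ n" for F n
    by (simp add: S_def fps_compose_linear)
  have S_mult: "S (F * G) = S F * S G" for F G
    unfolding S_def by (rule fps_compose_mult_distrib) simp
  have E: "E = (1 + fps_X) * S E"
  proof (rule fps_ext)
    fix n
    show "E $ n = ((1 + fps_X) * S E) $ n"
    proof (cases n)
      case 0
      then show ?thesis by (simp add: S_nth)
    next
      case (Suc k)
      have "E $ Suc k = Q ^ Suc k * E $ Suc k + Q ^ (Suc k choose 2)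
          * ((1 - Q ^ Suc k) * inverse (qpoch Q Q (Suc k)))"
        by (simp add: E_def algebra_simps)
      \<comment> \<open>\<open>Suc k choose 2 = k + (k choose 2)\<close> splits off the factor
        \<open>Q ^ k\<close> that \<open>S\<close> puts on coefficient \<open>k\<close>.\<close>
      also have "\<dots> = Q ^ Suc k * E $ Suc k + Q ^ k * E $ k"
        unfolding inverse_qpoch_Suc[OF Q]
        by (simp add: E_def numeral_2_eq_2 power_add mult.assoc)
      finally show ?thesis
        by (simp add: Suc S_nth distrib_right)
    qed
  qed
  have D: "(1 - fps_X ^ 2) * D = S D"
  proof (rule fps_ext)
    fix n
    consider "n = 0" | "n = 1" | k where "n = Suc (Suc k)"
      by (metis One_nat_def not0_implies_Suc)
    then show "((1 - fps_X ^ 2) * D) $ n = S D $ n"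
    proof cases
      case (3 k)
      have "D $ k = (1 - Q ^ Suc (Suc k)) * D $ Suc (Suc k)"
      proof (cases "even k")
        case True
        then obtain m where m: "k = 2 * m" by blast
        have "(1 - (Q^2) ^ Suc m) * inverse (qpoch (Q^2) (Q^2) (Suc m))
            = inverse (qpoch (Q^2) (Q^2) m)"
          by (rule inverse_qpoch_Suc) (simp add: Q)
        moreover have "(Q^2) ^ Suc m = Q ^ Suc (Suc k)"
          by (simp add: m power_mult power2_eq_square mult.assoc)
        ultimately show ?thesis by (simp add: D_def m)
      qed (simp add: D_def)
      then show ?thesis
        by (simp add: 3 S_nth left_diff_distrib fps_X_power_mult_nth)
    qed (simp_all add: S_nth left_diff_distrib fps_X_power_mult_nth D_def)
  qed
  \<comment> \<open>The extra factor \<open>1 + z\<close> completes \<open>1 - z\<close> to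
    \<open>1 - z^2\<close>, so that the equation for \<open>D\<close> applies; the equation for
    \<open>E\<close> returns the same factor, and it cancels in the integral domain.\<close>
  have "(1 + fps_X) * ((1 - fps_X) * (E * D)) = E * ((1 - fps_X ^ 2) * D)"
    by (simp add: algebra_simps power2_eq_square)
  also have "\<dots> = (1 + fps_X) * S (E * D)"
    by (subst E) (simp add: D S_mult mult.assoc)
  finally have "(1 + fps_X) * ((1 - fps_X) * (E * D)) = (1 + fps_X) * S (E * D)" .
  moreover have "1 + fps_X \<noteq> (0 :: 'a fps fps)"
    by (auto simp: fps_eq_iff intro!: exI[of _ 0])
  ultimately have B: "(1 - fps_X) * (E * D) = S (E * D)"
    by simp
  have "(E * D) $ n = inverse (qpoch Q Q n)"
  proof (induction n)
    case 0
    then show ?case by (simp add: E_def D_def qpoch_def binomial_eq_0)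
  next
    case (Suc n)
    have "((1 - fps_X) * (E * D)) $ Suc n = (E * D) $ Suc n - (E * D) $ n"
      by (simp add: left_diff_distrib)
    then have "(1 - Q ^ Suc n) * (E * D) $ Suc n = (E * D) $ n"
      unfolding B S_nth by (simp add: algebra_simps)
    also have "\<dots> = (1 - Q ^ Suc n) * inverse (qpoch Q Q (Suc n))"
      by (simp only: Suc.IH inverse_qpoch_Suc[OF Q])
    finally have "(1 - Q ^ Suc n) * (E * D) $ Suc n =
        (1 - Q ^ Suc n) * inverse (qpoch Q Q (Suc n))" .
    moreover have "(1 - Q ^ Suc n) $ 0 \<noteq> 0"
      by (simp add: Q)
    then have "1 - Q ^ Suc n \<noteq> 0" by (metis fps_zero_nth)
    ultimately show ?case
      by (metis mult_left_cancel)
  qed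
  moreover have "(E * D) $ n = (\<Sum>r=0..n. if even (n - r) then
       Q ^ (r choose 2) * inverse (qpoch Q Q r) * inverse (qpoch (Q^2) (Q^2) ((n - r) div 2)) else 0)"
    unfolding fps_mult_nth by (intro sum.cong) (simp_all add: E_def D_def)
  moreover have "{r. r \<le> n \<and> even (n - r)} = {r \<in> {0..n}. even (n - r)}"
    by auto
  ultimately show ?thesis
    by (simp only: sum.inter_filter finite_atLeastAtMost)
qed

section \<open>Euler's identity, by telescoping\<close>

text \<open>
  Writing \<open>G k M\<close> for the sum below with \<open>n \<le> M\<close>, the factor \<open>1 - q^(2n)\<close> cancels
  in \<open>G k M - G (k + 1) M\<close>; this gives \<open>G k = (1 + q^(2k+1)) G (k + 1)\<close> up to the
  last summand.
\<close>
lemma euler_sum_step: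
  fixes k :: nat
  defines "G \<equiv> \<lambda>k M. \<Sum>n\<le>M. fps_X ^ (n^2 + 2 * k * n) *
    inverse (qpoch (fps_X^2) (fps_X^2) n) :: 'a::field fps"
  shows "fps_X ^ M dvd G k M - (1 + fps_X ^ (2 * k + 1)) * G (Suc k) M"
proof -
  define u :: "nat \<Rightarrow> 'a fps" where "u n = inverse (qpoch (fps_X^2) (fps_X^2) n)" for n
  have u: "(1 - fps_X ^ (2 * Suc n)) * u (Suc n) = u n" for n
    using inverse_qpoch_Suc[of "fps_X ^ 2 :: 'a fps" n] unfolding u_def power_mult by simp
  \<comment> \<open>The induction on \<open>M\<close> needs the exact defect: divisibility by
    \<open>fps_X ^ M\<close> alone would not give the next power.\<close>
  have "G k M - (1 + fps_X ^ (2 * k + 1)) * G (Suc k) M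
      = - (fps_X ^ (2 * k + 1 + M^2 + 2 * Suc k * M) * u M)"
  proof (induction M)
    case 0
    show ?case by (simp add: G_def u_def algebra_simps)
  next
    case (Suc M)
    have step: "fps_X ^ ((Suc M)^2 + 2 * k * Suc M) * u (Suc M)
        - fps_X ^ ((Suc M)^2 + 2 * Suc k * Suc M) * u (Suc M)
        = fps_X ^ (2 * k + 1 + M^2 + 2 * Suc k * M) * u M"
    proof -
      have exps: "(Suc M)^2 + 2 * Suc k * Suc M = (Suc M)^2 + 2 * k * Suc M + 2 * Suc M"
        "(Suc M)^2 + 2 * k * Suc M = 2 * k + 1 + M^2 + 2 * Suc k * M"
        by (simp_all add: algebra_simps power2_eq_square)
      have "fps_X ^ ((Suc M)^2 + 2 * k * Suc M) * u (Suc M)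
          - fps_X ^ ((Suc M)^2 + 2 * Suc k * Suc M) * u (Suc M)
          = fps_X ^ ((Suc M)^2 + 2 * k * Suc M) * ((1 - fps_X ^ (2 * Suc M)) * u (Suc M))"
        unfolding exps(1)
        by (simp only: power_add left_diff_distrib right_diff_distrib mult.assoc mult_1)
      then show ?thesis unfolding u exps(2) .
    qed
    have G_Suc: "G j (Suc M) = G j M + fps_X ^ ((Suc M)^2 + 2 * j * Suc M) * u (Suc M)" for j
      by (simp add: G_def u_def)
    have "fps_X ^ (2 * k + 1 + (Suc M)^2 + 2 * Suc k * Suc M) * u (Suc M)
      = fps_X ^ (2 * k + 1) * (fps_X ^ ((Suc M)^2 + 2 * Suc k * Suc M) * u (Suc M))"
      by (simp only: power_add mult.assoc)
    moreover have "(g + a) - (1 + x) * (h + b) = - (x * b)"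
      if "g - (1 + x) * h = - c" "a - b = c" for a b c g h x :: "'a fps"
      using that by algebra
    ultimately show ?case
      using Suc.IH step unfolding G_Suc by metis
  qed
  moreover have "fps_X ^ M dvd (fps_X ^ (2 * k + 1 + M^2 + 2 * Suc k * M) :: 'a fps)"
    by (rule le_imp_power_dvd) simp
  ultimately show ?thesis by simp
qed

lemma fps_nth_eq_if_dvd_diff:
  fixes f g :: "'a::comm_ring_1 fps"
  assumes "fps_X ^ m dvd f - g" "i < m"
  shows "f $ i = g $ i"
proof -
  obtain h where "f - g = fps_X ^ m * h" using assms(1) by blast
  then have "(f - g) $ i = 0" using assms(2) by (simp add: fps_X_power_mult_nth)
  then show ?thesis by simp
qed

text \<open>Starting at \<open>k = 0\<close>, \<open>N\<close> uses of \<open>euler_sum_step\<close>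
  split off the \<open>N\<close> factors. The sum that remains is 1 up to order \<open>i\<close>:
  its terms with \<open>n \<ge> 1\<close> have exponent \<open>n^2 + 2 * N * n > i\<close>.\<close>

lemma euler_sum_nth:
  assumes "i \<le> N"
  shows "(\<Sum>n\<le>i. fps_X ^ n^2 * inverse (qpoch (fps_X^2) (fps_X^2) n) :: 'a::field fps) $ i
    = (\<Prod>j<N. 1 + fps_X ^ (2 * j + 1)) $ i"
proof -
  define G :: "nat \<Rightarrow> nat \<Rightarrow> 'a fps" where "G k M = (\<Sum>n\<le>M. fps_X ^ (n^2 + 2 * k * n) *
    inverse (qpoch (fps_X^2) (fps_X^2) n))" for k M
  define M where "M = Suc i"
  have "fps_X ^ M dvd G 0 M - (\<Prod>j<K. 1 + fps_X ^ (2 * j + 1)) * G K M" for K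
  proof (induction K)
    case (Suc K)
    have "fps_X ^ M dvd G K M - (1 + fps_X ^ (2 * K + 1)) * G (Suc K) M"
      unfolding G_def by (rule euler_sum_step)
    then have "fps_X ^ M dvd (\<Prod>j<K. 1 + fps_X ^ (2 * j + 1)) *
        (G K M - (1 + fps_X ^ (2 * K + 1)) * G (Suc K) M)"
      by (rule dvd_mult)
    from dvd_add[OF Suc.IH this] show ?case
      by (simp add: right_diff_distrib mult.assoc)
  qed simp
  moreover have "fps_X ^ M dvd G N M - 1"
  proof -
    have "G N M = (\<Sum>n=0..M. fps_X ^ (n^2 + 2 * N * n) * inverse (qpoch (fps_X^2) (fps_X^2) n))"
      by (simp add: G_def atLeast0AtMost)
    also have "\<dots> = 1 + (\<Sum>n=Suc 0..M. fps_X ^ (n^2 + 2 * N * n) *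
        inverse (qpoch (fps_X^2) (fps_X^2) n))"
      by (subst sum.atLeast_Suc_atMost) (simp_all add: qpoch_def)
    finally have "G N M - 1 = (\<Sum>n=Suc 0..M. fps_X ^ (n^2 + 2 * N * n) *
        inverse (qpoch (fps_X^2) (fps_X^2) n))" by simp
    moreover have "M \<le> n^2 + 2 * N * n" if "n \<in> {Suc 0..M}" for n
    proof -
      have "1 \<le> n^2" using that by simp
      moreover have "N * 1 \<le> 2 * N * n" using that by (intro mult_mono) simp_all
      ultimately show ?thesis using assms unfolding M_def by linarith
    qed
    ultimately show ?thesis
      by (auto intro!: dvd_sum dvd_mult2 le_imp_power_dvd)
  qed
  then have "fps_X ^ M dvd (\<Prod>j<N. 1 + fps_X ^ (2 * j + 1)) * (G N M - 1)"
    by (rule dvd_mult)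
  ultimately have "fps_X ^ M dvd (G 0 M - (\<Prod>j<N. 1 + fps_X ^ (2 * j + 1)) * G N M)
      + (\<Prod>j<N. 1 + fps_X ^ (2 * j + 1)) * (G N M - 1)"
    by (intro dvd_add) auto
  then have "fps_X ^ M dvd G 0 M - (\<Prod>j<N. 1 + fps_X ^ (2 * j + 1))"
    by (simp add: algebra_simps)
  then have "G 0 M $ i = (\<Prod>j<N. 1 + fps_X ^ (2 * j + 1)) $ i"
    by (rule fps_nth_eq_if_dvd_diff) (simp add: M_def)
  \<comment> \<open>The surplus summand \<open>n = i + 1\<close> has order at least
    \<open>(i + 1)^2\<close>.\<close>
  moreover have "G 0 M $ i = G 0 i $ i"
  proof -
    have "i < (Suc i)^2" by (simp add: power2_eq_square)
    then show ?thesis by (simp add: G_def M_def fps_X_power_mult_nth)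
  qed
  ultimately show ?thesis by (simp add: G_def)
qed

section \<open>Regrouping the double sum by \<open>n = 2 * m + r\<close>\<close>

lemma double_sum_eq_euler_sum:
  "(\<Sum>(m, r) | 2 * m + r \<le> i. fps_X ^ (4 * m^2 + 4 * m * r + 2 * r^2 - r)
      / (qpoch (fps_X^4) (fps_X^4) m * qpoch (fps_X^2) (fps_X^2) r))
    = (\<Sum>n\<le>i. fps_X ^ n^2 * inverse (qpoch (fps_X^2) (fps_X^2) n) :: 'a::field fps)"
    (is "sum ?t ?I = _")
proof -
  define Q :: "'a fps" where "Q = fps_X ^ 2"
  have Q0: "Q $ 0 = 0" by (simp add: Q_def)
  have Q4: "fps_X ^ 4 = Q ^ 2" by (simp add: Q_def flip: power_mult)
  have t: "?t (m, r) = fps_X ^ (2 * m + r)^2 *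
      (Q ^ (r choose 2) * inverse (qpoch Q Q r) * inverse (qpoch (Q^2) (Q^2) m))" for m r
  proof -
    have "2 * (r choose 2) = r * (r - 1)"
      by (cases r) (simp_all add: choose_two)
    \<comment> \<open>The case \<open>r = 0\<close> is separated because of the subtraction on
      \<open>nat\<close>.\<close>
    then have "4 * m^2 + 4 * m * r + 2 * r^2 - r = (2 * m + r)^2 + 2 * (r choose 2)"
      by (cases r) (simp_all add: algebra_simps power2_eq_square)
    then have "fps_X ^ (4 * m^2 + 4 * m * r + 2 * r^2 - r)
        = fps_X ^ (2 * m + r)^2 * Q ^ (r choose 2)"
      by (simp add: power_add Q_def power_mult)
    moreover have "(qpoch (Q^2) (Q^2) m * qpoch Q Q r) $ 0 \<noteq> 0"
      by (simp add: qpoch_nth_0 Q0)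
    ultimately show ?thesis
      by (simp add: Q4 flip: Q_def) (simp add: fps_divide_unit fps_inverse_mult mult_ac)
  qed
  have "(\<Sum>n\<le>i. fps_X ^ n^2 * inverse (qpoch Q Q n))
    = (\<Sum>n\<le>i. \<Sum>r | r \<le> n \<and> even (n - r). ?t ((n - r) div 2, r))"
  proof (rule sum.cong)
    fix n
    have "fps_X ^ n^2 * inverse (qpoch Q Q n) =
        (\<Sum>r | r \<le> n \<and> even (n - r). fps_X ^ n^2 * (Q ^ (r choose 2) * inverse (qpoch Q Q r)
          * inverse (qpoch (Q^2) (Q^2) ((n - r) div 2))))"
      by (subst inverse_qpoch_eq_sum[OF Q0]) (simp only: sum_distrib_left)
    also have "\<dots> = (\<Sum>r | r \<le> n \<and> even (n - r). ?t ((n - r) div 2, r))"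
    proof (rule sum.cong)
      fix r assume "r \<in> {r. r \<le> n \<and> even (n - r)}"
      then have "2 * ((n - r) div 2) + r = n"
        by (simp del: even_diff_nat)
      then show "fps_X ^ n^2 * (Q ^ (r choose 2) * inverse (qpoch Q Q r)
          * inverse (qpoch (Q^2) (Q^2) ((n - r) div 2))) = ?t ((n - r) div 2, r)"
        unfolding t by (simp only:)
    qed simp
    finally show "fps_X ^ n^2 * inverse (qpoch Q Q n) =
        (\<Sum>r | r \<le> n \<and> even (n - r). ?t ((n - r) div 2, r))" .
  qed simp
  also have "\<dots> = (\<Sum>(n, r) \<in> (SIGMA n:{..i}. {r. r \<le> n \<and> even (n - r)}). ?t ((n - r) div 2, r))"
    by (rule sum.Sigma) auto
  also have "\<dots> = sum ?t ?I"
    \<comment> \<open>The parity condition on \<open>n - r\<close> makes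
      \<open>m = (n - r) div 2\<close> exact.\<close>
    by (rule sum.reindex_bij_witness[of _ "\<lambda>(m, r). (2 * m + r, r)" "\<lambda>(n, r). ((n - r) div 2, r)"])
       auto
  finally show ?thesis by (simp add: Q_def)
qed

section \<open>Convergence of both sides to a common limit\<close>

theorem theorem4:
  fixes q :: "'a::field fps"
  defines "q \<equiv> fps_X"
  defines "t \<equiv> (\<lambda>(m::nat, r::nat).
             q ^ (4 * m^2 + 4 * m * r + 2 * r^2 - r)
               / (qpoch (q^4) (q^4) m * qpoch (q^2) (q^2) r))"
  defines "p \<equiv> (\<lambda>n::nat. 1 + q ^ (2 * Suc n - 1))"
  shows "t summable_on UNIV \<and> convergent_prod p \<and>
         infsum t UNIV = (\<Prod>n. p n)"
proof -
  \<comment> \<open>The factors \<open>p j\<close> with \<open>j \<ge> i\<close> do not affect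
    coefficient \<open>i\<close>, so the diagonal choice gives the limit of the partial
    products.\<close>
  define L where "L = Abs_fps (\<lambda>i. (\<Prod>j<i. p j) $ i)"
  have p: "p = (\<lambda>j. 1 + fps_X ^ (2 * j + 1))"
    by (simp add: p_def q_def)
  have L_nth: "(\<Prod>j<N. p j) $ i = L $ i" if "i \<le> N" for i N
    using euler_sum_nth[OF that, where 'a='a] euler_sum_nth[OF order_refl, of i, where 'a='a]
    by (simp add: L_def p)
  have "(\<lambda>n. \<Prod>j\<le>n. p j) \<longlonglongrightarrow> L"
  proof (rule tendsto_fpsI)
    fix i
    show "\<forall>\<^sub>F n in sequentially. (\<Prod>j\<le>n. p j) $ i = L $ i"
      using eventually_ge_at_top[of i]
      by eventually_elim (unfold lessThan_Suc_atMost [symmetric], rule L_nth, simp)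
  qed
  moreover have "L $ 0 = 1" by (simp add: L_def)
  \<comment> \<open>Convergence of a product in the library's sense demands a nonzero limit.\<close>
  then have "L \<noteq> 0" by auto
  ultimately have "raw_has_prod p 0 L"
    by (simp add: raw_has_prod_def)
  then have "convergent_prod p" "(\<Prod>n. p n) = L"
    by (auto simp: convergent_prod_def has_prod_def intro!: has_prod_unique[symmetric])
  moreover have "(t has_sum L) UNIV"
    unfolding has_sum_def
  proof (rule tendsto_fpsI)
    fix i :: nat
    \<comment> \<open>Outside this finite triangle every term has order above \<open>i\<close>, so
      any finite set containing \<open>I\<close> already gives the final coefficient
      \<open>i\<close>.\<close>
    define I where "I = {(m, r). 2 * m + r \<le> i}"
    have "I \<subseteq> {..i} \<times> {..i}" by (auto simp: I_def)
    then have fin: "finite I" by (rule finite_subset) simp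
    have zero: "t (m, r) $ i = 0" if "(m, r) \<notin> I" for m r
    proof -
      have "i < 2 * m + r" using that by (simp add: I_def)
      also have "\<dots> \<le> 4 * m^2 + r^2"
        by (intro add_mono) (simp_all add: power2_eq_square)
      also have "\<dots> \<le> 4 * m^2 + 4 * m * r + 2 * r^2 - r"
        using le_square[of r] unfolding power2_eq_square by linarith
      finally have "i < 4 * m^2 + 4 * m * r + 2 * r^2 - r" .
      moreover have "(qpoch (q^4) (q^4) m * qpoch (q^2) (q^2) r) $ 0 \<noteq> 0"
        by (simp add: qpoch_nth_0 q_def)
      ultimately show ?thesis
        by (simp add: t_def fps_divide_unit) (simp add: q_def fps_X_power_mult_nth)
    qed
    have I: "sum t I $ i = L $ i"
      using double_sum_eq_euler_sum[of i, where 'a='a] euler_sum_nth[OF order_refl, of i, where 'a='a]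
      by (simp add: L_def t_def p q_def I_def)
    have "\<forall>\<^sub>F F in finite_subsets_at_top UNIV. finite F \<and> I \<subseteq> F \<and> F \<subseteq> UNIV"
      using fin by (subst eventually_finite_subsets_at_top) blast
    then show "\<forall>\<^sub>F F in finite_subsets_at_top UNIV. sum t F $ i = L $ i"
    proof eventually_elim
      case (elim F)
      then have "(\<Sum>x\<in>F. t x $ i) = (\<Sum>x\<in>I. t x $ i)"
        by (intro sum.mono_neutral_right) (auto simp: zero)
      with I show ?case by (simp add: fps_sum_nth)
    qed
  qed
  ultimately show ?thesis
    by (auto simp: summable_on_def infsumI)
qed

end
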